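(* Up to combinatorial equivalence, the set of Forman--Ricci-positive $3$-dimensional polytopes is finite, and every polytope in this set has at most $15$ vertices.
   Context: Polytopes are convex polytopes, considered up to combinatorial equivalence. For an edge $e$ of a polytope $P$, let $\mathcal{F}\uparrow(e)$ be the set of $2$-faces of $P$ containing $e$. Two distinct edges $e,e'$ are parallel neighbors if either (i) they share a vertex but are not contained in a common $2$-face, or (ii) they are vertex-disjoint but are contained in a common $2$-face. Let $\mathcal{E}(e)$ be the set of parallel neighbors of $e$. The Forman--Ricci curvature of $e$ is $\mathcal{F}(e)=|\mathcal{F}\uparrow(e)|+2-|\mathcal{E}(e)|$. A polytope is Forman--Ricci-positive if $\mathcal{F}(e)>0$ for every edge $e$. *)

theory Defs
  imports "HOL-Analysis.Polytope"
begin

definition vertices :: "'a::euclidean_space set \<Rightarrow> 'a set" where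
  "vertices P = {v. v extreme_point_of P}"

definition edges :: "'a::euclidean_space set \<Rightarrow> 'a set set" where
  "edges P = {e. e edge_of P}"

definition two_faces :: "'a::euclidean_space set \<Rightarrow> 'a set set" where
  "two_faces P = {F. F face_of P \<and> aff_dim F = 2}"

definition two_faces_above :: "'a::euclidean_space set \<Rightarrow> 'a set \<Rightarrow> 'a set set" where
  "two_faces_above P e = {F \<in> two_faces P. e \<subseteq> F}"

definition in_common_two_face :: "'a::euclidean_space set \<Rightarrow> 'a set \<Rightarrow> 'a set \<Rightarrow> bool" where
  "in_common_two_face P e e' \<longleftrightarrow> (\<exists>F \<in> two_faces P. e \<subseteq> F \<and> e' \<subseteq> F)"

definition parallel_neighbors :: "'a::euclidean_space set \<Rightarrow> 'a set \<Rightarrow> 'a set set" where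
  "parallel_neighbors P e =
     {e' \<in> edges P. e' \<noteq> e \<and>
        ((vertices e \<inter> vertices e' \<noteq> {} \<and> \<not> in_common_two_face P e e') \<or>
         (vertices e \<inter> vertices e' = {} \<and> in_common_two_face P e e'))}"

definition forman_ricci :: "'a::euclidean_space set \<Rightarrow> 'a set \<Rightarrow> int" where
  "forman_ricci P e =
     int (card (two_faces_above P e)) + 2 - int (card (parallel_neighbors P e))"

definition forman_ricci_positive :: "'a::euclidean_space set \<Rightarrow> bool" where
  "forman_ricci_positive P \<longleftrightarrow> (\<forall>e \<in> edges P. forman_ricci P e > 0)"

(* Isomorphism of face lattices; face_of admits both {} and P as faces of P. *)
definition combinatorially_equivalent ::
    "'a::euclidean_space set \<Rightarrow> 'b::euclidean_space set \<Rightarrow> bool" where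
  "combinatorially_equivalent P Q \<longleftrightarrow>
     (\<exists>f. bij_betw f {F. F face_of P} {G. G face_of Q} \<and>
          (\<forall>F F'. F face_of P \<longrightarrow> F' face_of P \<longrightarrow> (F \<subseteq> F' \<longleftrightarrow> f F \<subseteq> f F')))"

definition comb_equiv_rel :: "('a::euclidean_space set \<times> 'a set) set" where
  "comb_equiv_rel = {(P, Q). polytope P \<and> polytope Q \<and> combinatorially_equivalent P Q}"

(* The dimension is that of the polytope itself; the ambient space 'a is arbitrary. *)
definition forman_ricci_positive_3polytopes :: "'a::euclidean_space set set" where
  "forman_ricci_positive_3polytopes =
     {P. polytope P \<and> aff_dim P = 3 \<and> forman_ricci_positive P}"

lemma combinatorially_equivalent_refl: "combinatorially_equivalent P P"
  unfolding combinatorially_equivalent_def by (rule exI[of _ id]) auto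

lemma combinatorially_equivalent_sym:
  assumes "combinatorially_equivalent P Q"
  shows "combinatorially_equivalent Q P"
proof -
  obtain f where b: "bij_betw f {F. F face_of P} {G. G face_of Q}"
    and m: "\<And>F F'. F face_of P \<Longrightarrow> F' face_of P \<Longrightarrow> F \<subseteq> F' \<longleftrightarrow> f F \<subseteq> f F'"
    using assms unfolding combinatorially_equivalent_def by blast
  let ?g = "inv_into {F. F face_of P} f"
  have g: "?g G face_of P" "f (?g G) = G" if "G face_of Q" for G
    using b that bij_betw_inv_into_right[OF b] bij_betw_apply[OF bij_betw_inv_into[OF b]] by auto
  have "G \<subseteq> G' \<longleftrightarrow> ?g G \<subseteq> ?g G'" if "G face_of Q" "G' face_of Q" for G G'
    using m[OF g(1)[OF that(1)] g(1)[OF that(2)]] g(2) that by simp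
  then show ?thesis
    unfolding combinatorially_equivalent_def using bij_betw_inv_into[OF b] by blast
qed

lemma combinatorially_equivalent_trans:
  assumes "combinatorially_equivalent P Q" "combinatorially_equivalent Q R"
  shows "combinatorially_equivalent P R"
proof -
  obtain f where b: "bij_betw f {F. F face_of P} {G. G face_of Q}"
    and m: "\<And>F F'. F face_of P \<Longrightarrow> F' face_of P \<Longrightarrow> F \<subseteq> F' \<longleftrightarrow> f F \<subseteq> f F'"
    using assms(1) unfolding combinatorially_equivalent_def by blast
  obtain g where c: "bij_betw g {F. F face_of Q} {G. G face_of R}"
    and n: "\<And>F F'. F face_of Q \<Longrightarrow> F' face_of Q \<Longrightarrow> F \<subseteq> F' \<longleftrightarrow> g F \<subseteq> g F'"
    using assms(2) unfolding combinatorially_equivalent_def by blast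
  have "f F face_of Q" if "F face_of P" for F
    using bij_betw_apply[OF b] that by auto
  then have "F \<subseteq> F' \<longleftrightarrow> (g \<circ> f) F \<subseteq> (g \<circ> f) F'" if "F face_of P" "F' face_of P" for F F'
    using m n that by simp
  then show ?thesis
    unfolding combinatorially_equivalent_def using bij_betw_trans[OF b c] by blast
qed

lemma equiv_comb_equiv_rel:
  "equiv {P::'a::euclidean_space set. polytope P} comb_equiv_rel"
  unfolding comb_equiv_rel_def
  by (intro equivI refl_onI symI transI)
     (auto intro: combinatorially_equivalent_refl combinatorially_equivalent_sym
        combinatorially_equivalent_trans)

end

theory Submission
  imports Defs "HOL-Analysis.Analysis"
begin

text \<open>For an edge $e$ whose ends have degrees $p, q$ and whose two faces have $f, g$ sides, the
  Forman--Ricci curvature is $16 - (p + q + f + g)$, so positivity means $p + q + f + g \le 15$.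
  Summing $1/p + 1/q + 1/f + 1/g - 1$ over all edges gives $V - E + F \le 2$, while the bound on
  $p + q + f + g$ makes each summand at least $(1/p + 1/q)/7$, and these add up to $V/7$. Hence
  $V \le 14$, and finitely many vertices allow only finitely many face lattices.

  The inequality $V - E + F \le 2$ is obtained by sweeping with a generic linear functional:
  every edge and every 2-face is counted at its lowest vertex, and at a vertex that is neither the
  minimum nor the maximum there are strictly more such edges than such 2-faces. The local structure
  at a vertex is read off its vertex figure.\<close>

section \<open>Slices and vertex figures\<close>

text \<open>\<open>rel_interior S\<close> is open in \<open>affine hull S\<close>, so its slice has
  the dimension of the sliced hull, and the slice of \<open>S\<close> lies between the two. A
  hyperplane touching only the relative boundary could cut out something of smaller
  dimension.\<close>

lemma aff_dim_slice:
  fixes S :: "'a::euclidean_space set"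
  assumes "rel_interior S \<inter> {x. a \<bullet> x = b} \<noteq> {}" and "\<not> S \<subseteq> {x. a \<bullet> x = b}"
  shows "aff_dim (S \<inter> {x. a \<bullet> x = b}) = aff_dim S - 1"
proof -
  let ?H = "{x. a \<bullet> x = b}"
  have aff: "affine (affine hull S \<inter> ?H)"
    by (simp add: affine_Int affine_hyperplane)
  have sub: "rel_interior S \<subseteq> S" "S \<subseteq> affine hull S"
    by (auto simp: rel_interior_subset hull_subset)
  have "aff_dim (affine hull S \<inter> ?H) = aff_dim S - 1"
    using assms sub aff_dim_affine_Int_hyperplane[of "affine hull S" a b] by auto
  moreover have "aff_dim (rel_interior S \<inter> ?H) = aff_dim (affine hull S \<inter> ?H)"
  proof (rule aff_dim_openin[OF _ aff assms(1)])
    obtain T where "open T" "rel_interior S = affine hull S \<inter> T"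
      using openin_rel_interior[of S] by (auto simp: openin_open)
    then have "rel_interior S \<inter> ?H = (affine hull S \<inter> ?H) \<inter> T" by blast
    with \<open>open T\<close> show "openin (top_of_set (affine hull S \<inter> ?H)) (rel_interior S \<inter> ?H)"
      by (auto simp: openin_open)
  qed
  moreover have "aff_dim (rel_interior S \<inter> ?H) \<le> aff_dim (S \<inter> ?H)"
    "aff_dim (S \<inter> ?H) \<le> aff_dim (affine hull S \<inter> ?H)"
    using sub by (auto intro!: aff_dim_subset)
  ultimately show ?thesis by linarith
qed

text \<open>\<open>S\<close> lies in the closure of its relative interior, so both open half-spaces
  contain relatively interior points; a connected set with points on both sides meets the
  hyperplane.\<close>

lemma rel_interior_meets_hyperplane:
  fixes S :: "'a::euclidean_space set"
  assumes S: "convex S" and u: "u \<in> S" "a \<bullet> u < b" and w: "w \<in> S" "b < a \<bullet> w"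
  shows "rel_interior S \<inter> {x. a \<bullet> x = b} \<noteq> {}"
proof -
  have cl: "S \<subseteq> closure (rel_interior S)"
    by (simp add: S closure_subset convex_closure_rel_interior)
  have "{x. a \<bullet> x < b} \<inter> rel_interior S \<noteq> {}" "{x. b < a \<bullet> x} \<inter> rel_interior S \<noteq> {}"
    using open_Int_closure_eq_empty[OF open_halfspace_lt, of a b "rel_interior S"]
      open_Int_closure_eq_empty[OF open_halfspace_gt, of b a "rel_interior S"] u w cl by blast+
  then obtain x y where "x \<in> rel_interior S" "a \<bullet> x < b" "y \<in> rel_interior S" "b < a \<bullet> y"
    by blast
  then show ?thesis
    using connected_ivt_hyperplane[of "rel_interior S" x y a b] S
    by (auto simp: convex_rel_interior convex_connected)
qed

text \<open>The smallest face through \<open>y\<close> works: if \<open>y\<close> lay on its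
  relative boundary, a facet of that face through \<open>y\<close> would be smaller still.\<close>

lemma rel_interior_of_face_exists:
  fixes P :: "'a::euclidean_space set"
  assumes "polytope P" "y \<in> P"
  obtains F where "F face_of P" "y \<in> rel_interior F"
proof -
  define F where "F = \<Inter>{F. F face_of P \<and> y \<in> F}"
  have "P face_of P" using assms by (simp add: face_of_refl polytope_imp_convex)
  then have F: "F face_of P"
    unfolding F_def using assms by (intro face_of_Inter) auto
  have "y \<in> F" by (simp add: F_def)
  have "y \<in> rel_interior F"
  proof (rule ccontr)
    assume "y \<notin> rel_interior F"
    moreover have "polyhedron F"
      using F assms face_of_polytope_polytope polytope_imp_polyhedron by blast
    ultimately obtain G where G: "G facet_of F" "y \<in> G"
      using \<open>y \<in> F\<close> rel_boundary_of_polyhedron by blast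
    then have "G face_of P"
      using F facet_of_imp_face_of[of G F] face_of_trans[of G F P] by simp
    then have "F \<subseteq> G"
      using G unfolding F_def by (intro Inter_lower) simp
    then have "F = G"
      using facet_of_imp_subset[OF G(1)] by simp
    with G show False by simp
  qed
  with F that show ?thesis by blast
qed

section \<open>Vertices of polytopes and of their faces\<close>

lemma polytope_eq_convex_hull_vertices:
  fixes P :: "'a::euclidean_space set"
  shows "polytope P \<Longrightarrow> P = convex hull (vertices P)"
  unfolding vertices_def by (simp add: Krein_Milman_Minkowski polytope_imp_compact polytope_imp_convex)

lemma finite_vertices: "polytope P \<Longrightarrow> finite (vertices P)"
  unfolding vertices_def by (simp add: finite_polyhedron_extreme_points polytope_imp_polyhedron)

lemma vertices_subset: "vertices P \<subseteq> P"
  by (auto simp: vertices_def extreme_point_of_def)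

lemma vertices_face: "F face_of P \<Longrightarrow> vertices F = vertices P \<inter> F"
  using extreme_point_of_face[of F P] by (auto simp: vertices_def)

text \<open>Each face is the convex hull of its vertices, so the face lattice can be read off from
  finite vertex sets.\<close>

lemma face_subset_iff_vertices:
  fixes P :: "'a::euclidean_space set"
  assumes "polytope P" "F face_of P" "G face_of P"
  shows "F \<subseteq> G \<longleftrightarrow> vertices F \<subseteq> vertices G"
proof
  assume "F \<subseteq> G" then show "vertices F \<subseteq> vertices G"
    using assms by (auto simp: vertices_face)
next
  assume "vertices F \<subseteq> vertices G"
  then show "F \<subseteq> G"
    using assms by (metis face_of_polytope_polytope hull_mono polytope_eq_convex_hull_vertices)
qed

text \<open>A linear functional on a polytope is largest at a vertex. In contrapositive form, a
  point above a level yields a vertex above it.\<close>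

lemma polytope_subset_halfspace_iff:
  fixes P :: "'a::euclidean_space set"
  assumes "polytope P"
  shows "P \<subseteq> {x. a \<bullet> x \<le> b} \<longleftrightarrow> vertices P \<subseteq> {x. a \<bullet> x \<le> b}"
proof
  assume "vertices P \<subseteq> {x. a \<bullet> x \<le> b}"
  then have "convex hull vertices P \<subseteq> {x. a \<bullet> x \<le> b}"
    by (simp add: hull_minimal convex_halfspace_le)
  then show "P \<subseteq> {x. a \<bullet> x \<le> b}"
    using polytope_eq_convex_hull_vertices[OF assms] by simp
qed (use vertices_subset[of P] in blast)

text \<open>A vertex of a polytope is exposed, so some functional is largest at \<open>v\<close>
  alone; the other vertices are finitely many, so a level \<open>b\<close> fits strictly
  between.\<close>

lemma vertex_separation:
  fixes P :: "'a::euclidean_space set"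
  assumes P: "polytope P" and v: "v \<in> vertices P"
  obtains a b where "b < a \<bullet> v" "\<And>w. w \<in> vertices P \<Longrightarrow> w \<noteq> v \<Longrightarrow> a \<bullet> w < b"
proof -
  have "{v} exposed_face_of P"
    using P v by (simp add: exposed_face_of_polyhedron polytope_imp_polyhedron face_of_singleton vertices_def)
  then obtain a d where P_le: "P \<subseteq> {x. a \<bullet> x \<le> d}" and eq: "{v} = P \<inter> {x. a \<bullet> x = d}"
    unfolding exposed_face_of_def by blast
  have lt: "a \<bullet> w < a \<bullet> v" if "w \<in> vertices P - {v}" for w
  proof -
    have "w \<in> P" "w \<noteq> v" using that vertices_subset[of P] by auto
    moreover have "a \<bullet> v = d" using eq by blast
    ultimately show ?thesis using P_le eq by (metis (mono_tags, lifting) IntI mem_Collect_eq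
      order_le_less singletonD subsetD)
  qed
  have "\<exists>b. b < a \<bullet> v \<and> (\<forall>w \<in> vertices P - {v}. a \<bullet> w < b)"
  proof (cases "vertices P - {v} = {}")
    case True then show ?thesis by (metis empty_iff lt_ex)
  next
    case False
    let ?M = "Max ((\<bullet>) a ` (vertices P - {v}))"
    have fin: "finite ((\<bullet>) a ` (vertices P - {v}))" using finite_vertices[OF P] by blast
    have "?M < a \<bullet> v" using False fin lt by (subst Max_less_iff) auto
    then obtain b where "?M < b" "b < a \<bullet> v" using dense by blast
    then show ?thesis using fin by (meson Max_ge imageI le_less_trans)
  qed
  then show ?thesis using that by blast
qed

text \<open>The hyperplane cuts \<open>v\<close> off from all other vertices, so its slice of
  \<open>P\<close> is the vertex figure at \<open>v\<close>: its nonempty faces are the slices of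
  the faces of \<open>P\<close> that properly contain \<open>v\<close>, with dimension lowered by
  one.\<close>

locale vertex_figure =
  fixes P :: "'a::euclidean_space set" and v a :: 'a and b :: real
  assumes polytope: "polytope P" and vertex: "v \<in> vertices P"
    and above: "b < a \<bullet> v"
    and below: "\<And>w. w \<in> vertices P \<Longrightarrow> w \<noteq> v \<Longrightarrow> a \<bullet> w < b"
begin

abbreviation H where "H \<equiv> {x. a \<bullet> x = b}"

lemma polytope_figure: "polytope (P \<inter> H)"
  by (simp add: polytope polytope_Int_polyhedron polyhedron_hyperplane)

text \<open>\<open>G\<close> has the vertex \<open>v\<close> above \<open>H\<close> and some other
  vertex below it.\<close>

lemma rel_interior_face_meets:
  assumes G: "G face_of P" "v \<in> G" "G \<noteq> {v}"
  shows "rel_interior G \<inter> H \<noteq> {}"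
proof -
  have pG: "polytope G" using polytope G face_of_polytope_polytope by blast
  have "vertices G \<noteq> {v}"
    using G polytope_eq_convex_hull_vertices[OF pG] by auto
  moreover have "v \<in> vertices G" using G vertex by (simp add: vertices_face)
  ultimately obtain w where "w \<in> vertices G" "w \<noteq> v" by blast
  then have "w \<in> G" "a \<bullet> w < b" using G below by (auto simp: vertices_face)
  then show ?thesis
    using rel_interior_meets_hyperplane[of G w a b v] G above pG polytope_imp_convex by blast
qed

lemma aff_dim_face_figure:
  assumes "G face_of P" "v \<in> G" "G \<noteq> {v}"
  shows "aff_dim (G \<inter> H) = aff_dim G - 1"
proof (rule aff_dim_slice[OF rel_interior_face_meets[OF assms]])
  show "\<not> G \<subseteq> H" using assms above by blast
qed

text \<open>\<open>H\<close> meets the relative interior of \<open>G\<close>, so a face containing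
  the slice of \<open>G\<close> contains a relatively interior point of \<open>G\<close>, and hence
  \<open>G\<close>. If \<open>G = {v}\<close>, the inclusion is clear from
  \<open>v \<in> G'\<close>.\<close>

lemma face_figure_subset_iff:
  assumes "G face_of P" "v \<in> G" "G' face_of P" "v \<in> G'"
  shows "G \<inter> H \<subseteq> G' \<inter> H \<longleftrightarrow> G \<subseteq> G'"
proof
  assume sub: "G \<inter> H \<subseteq> G' \<inter> H"
  show "G \<subseteq> G'"
  proof (cases "G = {v}")
    case False
    then have "G' \<inter> rel_interior G \<noteq> {}"
      using rel_interior_face_meets[of G] assms sub rel_interior_subset by blast
    then show ?thesis using assms subset_of_face_of face_of_imp_subset by blast
  qed (use assms in blast)
qed blast

lemma face_figure_face_of: "G face_of P \<Longrightarrow> G \<inter> H face_of P \<inter> H"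
  by (simp add: face_of_slice convex_hyperplane)

text \<open>Take \<open>y\<close> in the relative interior of \<open>K\<close> and the face
  \<open>G\<close> of \<open>P\<close> having \<open>y\<close> in its relative interior. Then
  \<open>K\<close> and \<open>G \<inter> H\<close> are faces of the figure whose relative interiors
  share \<open>y\<close>, so they coincide.\<close>

lemma face_figure_surj:
  assumes K: "K face_of P \<inter> H" "K \<noteq> {}"
  obtains G where "G face_of P" "v \<in> G" "G \<noteq> {v}" "K = G \<inter> H"
proof -
  have "convex K" using K face_of_imp_convex by blast
  then obtain y where y: "y \<in> rel_interior K" using K rel_interior_eq_empty by blast
  then have yPH: "y \<in> P \<inter> H" using K rel_interior_subset face_of_imp_subset by blast
  then obtain G where G: "G face_of P" "y \<in> rel_interior G"
    using rel_interior_of_face_exists polytope by blast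
  have pG: "polytope G" using polytope G face_of_polytope_polytope by blast
  have yG: "y \<in> G" using G rel_interior_subset by blast
  \<comment> \<open>Otherwise every vertex of \<open>G\<close> is strictly below \<open>H\<close>,
    and \<open>G\<close> would miss the point \<open>y\<close> of \<open>H\<close>.\<close>
  have "v \<in> G"
  proof (rule ccontr)
    assume "v \<notin> G"
    then have "vertices G \<subseteq> {x. a \<bullet> x < b}" using G below by (auto simp: vertices_face)
    then have "convex hull vertices G \<subseteq> {x. a \<bullet> x < b}"
      by (simp add: hull_minimal convex_halfspace_lt)
    then show False using yG yPH polytope_eq_convex_hull_vertices[OF pG] by auto
  qed
  moreover have "G \<noteq> {v}" using yG yPH above by force
  moreover have "rel_interior (G \<inter> H) = rel_interior G \<inter> H"
    using G yPH pG by (intro convex_affine_rel_interior_Int)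
      (auto simp: affine_hyperplane polytope_imp_convex)
  then have "K = G \<inter> H"
    using face_of_eq[OF K(1) face_figure_face_of[OF G(1)]] y yPH G by blast
  ultimately show ?thesis using that G by blast
qed

text \<open>\<open>E = {v}\<close> relates the edges at \<open>v\<close> to the vertices of the
  figure; for an edge \<open>E\<close>, the 2-faces on \<open>E\<close> become the figure's edges at
  the point \<open>E \<inter> H\<close>. The bound \<open>0 \<le> k\<close> ensures
  \<open>G \<noteq> {v}\<close> on one side and \<open>K \<noteq> {}\<close> on the other.\<close>

lemma bij_betw_figure:
  assumes E: "E face_of P" "v \<in> E" and "0 \<le> k"
  shows "bij_betw (\<lambda>G. G \<inter> H) {G. G face_of P \<and> aff_dim G = k + 1 \<and> E \<subseteq> G}
           {K. K face_of (P \<inter> H) \<and> aff_dim K = k \<and> E \<inter> H \<subseteq> K}"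
proof (rule bij_betwI')
  fix G G'
  assume "G \<in> {G. G face_of P \<and> aff_dim G = k + 1 \<and> E \<subseteq> G}"
    "G' \<in> {G. G face_of P \<and> aff_dim G = k + 1 \<and> E \<subseteq> G}"
  then show "(G \<inter> H = G' \<inter> H) = (G = G')"
    using E face_figure_subset_iff[of G G'] face_figure_subset_iff[of G' G] by blast
next
  fix G assume G: "G \<in> {G. G face_of P \<and> aff_dim G = k + 1 \<and> E \<subseteq> G}"
  then have "G \<noteq> {v}" using \<open>0 \<le> k\<close> by auto
  then show "G \<inter> H \<in> {K. K face_of (P \<inter> H) \<and> aff_dim K = k \<and> E \<inter> H \<subseteq> K}"
    using G E aff_dim_face_figure[of G] face_figure_face_of by auto
next
  fix K assume K: "K \<in> {K. K face_of (P \<inter> H) \<and> aff_dim K = k \<and> E \<inter> H \<subseteq> K}"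
  then have "K \<noteq> {}" using \<open>0 \<le> k\<close> by auto
  then obtain G where G: "G face_of P" "v \<in> G" "G \<noteq> {v}" "K = G \<inter> H"
    using K face_figure_surj by blast
  moreover from G have "E \<subseteq> G" using K E face_figure_subset_iff by blast
  ultimately show "\<exists>G \<in> {G. G face_of P \<and> aff_dim G = k + 1 \<and> E \<subseteq> G}. K = G \<inter> H"
    using K aff_dim_face_figure[of G] by auto
qed

lemma card_figure:
  assumes "E face_of P" "v \<in> E" and "0 \<le> k"
  shows "card {G. G face_of P \<and> aff_dim G = k + 1 \<and> E \<subseteq> G}
       = card {K. K face_of (P \<inter> H) \<and> aff_dim K = k \<and> E \<inter> H \<subseteq> K}"
  by (rule bij_betw_same_card[OF bij_betw_figure[OF assms]])

end

section \<open>Incidence counts\<close>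

text \<open>Polytopes of dimension at most one are simplices, and the vertices of a simplex are its
  affinely independent generators.\<close>

lemma card_vertices_dim1:
  fixes P :: "'a::euclidean_space set"
  assumes P: "polytope P" "aff_dim P = 1"
  shows "card (vertices P) = 2"
proof -
  obtain n where "n simplex P" using P polytope_lowdim_imp_simplex[of P] by auto
  moreover from this have "n = 1" using P aff_dim_simplex by metis
  ultimately obtain C where C: "\<not> affine_dependent C" "int (card C) = 2" "P = convex hull C"
    unfolding simplex_def by auto
  then have "vertices P = C"
    by (simp add: vertices_def extreme_point_of_convex_hull_affine_independent)
  with C show ?thesis by simp
qed

lemma card_vertices_gt_aff_dim:
  fixes P :: "'a::euclidean_space set"
  assumes "polytope P"
  shows "aff_dim P < int (card (vertices P))"
proof -
  have "aff_dim P = aff_dim (vertices P)"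
    using polytope_eq_convex_hull_vertices[OF assms] by (metis aff_dim_convex_hull)
  then show ?thesis using aff_dim_le_card[OF finite_vertices[OF assms]] by simp
qed

lemma card_faces_dim0:
  fixes P :: "'a::euclidean_space set"
  shows "card {K. K face_of P \<and> aff_dim K = 0} = card (vertices P)"
proof -
  have "{K. K face_of P \<and> aff_dim K = 0} = (\<lambda>x. {x}) ` vertices P"
    by (auto simp: vertices_def aff_dim_eq_0 face_of_singleton)
  then show ?thesis by (simp add: card_image)
qed

lemma ex_vertex_in_face:
  fixes P :: "'a::euclidean_space set"
  assumes "polytope P" "F face_of P" "F \<noteq> {}"
  obtains v where "v \<in> vertices P" "v \<in> F"
proof -
  have "polytope F" using assms face_of_polytope_polytope by blast
  then have "vertices F \<noteq> {}"
    using polytope_eq_convex_hull_vertices[of F] assms by auto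
  then show ?thesis using that vertices_face[of F P] assms by blast
qed

lemma edgesD:
  assumes "e \<in> edges P" shows "e face_of P" "aff_dim e = 1"
  using assms by (auto simp: edges_def edge_of_def)

lemma two_facesD:
  assumes "F \<in> two_faces P" shows "F face_of P" "aff_dim F = 2"
  using assms by (auto simp: two_faces_def)

lemma finite_edges: "polytope P \<Longrightarrow> finite (edges P)"
  by (rule finite_subset[OF _ finite_polytope_faces]) (auto simp: edges_def edge_of_def)

lemma finite_two_faces: "polytope P \<Longrightarrow> finite (two_faces P)"
  by (rule finite_subset[OF _ finite_polytope_faces]) (auto simp: two_faces_def)

lemma edges_face: "F face_of P \<Longrightarrow> edges F = {e \<in> edges P. e \<subseteq> F}"
  using face_of_face[of F P] by (auto simp: edges_def edge_of_def)

lemma card_vertices_edge: "polytope P \<Longrightarrow> e \<in> edges P \<Longrightarrow> card (vertices e) = 2"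
  using card_vertices_dim1 edgesD face_of_polytope_polytope by metis

lemma vertices_edge: "e \<in> edges P \<Longrightarrow> vertices e = vertices P \<inter> e"
  by (simp add: vertices_face edgesD)

context vertex_figure
begin

lemma card_edges_at: "card {e \<in> edges P. v \<in> e} = card (vertices (P \<inter> H))"
proof -
  have "{v} face_of P" using vertex by (simp add: vertices_def face_of_singleton)
  \<comment> \<open>The slice of \<open>{v}\<close> is empty, so the condition
    \<open>E \<inter> H \<subseteq> K\<close> holds for every \<open>K\<close>.\<close>
  moreover have "{v} \<inter> H = {}" using above by auto
  moreover have "{e \<in> edges P. v \<in> e} = {G. G face_of P \<and> aff_dim G = 0 + 1 \<and> {v} \<subseteq> G}"
    by (auto simp: edges_def edge_of_def)
  ultimately show ?thesis
    using card_figure[of "{v}" 0] card_faces_dim0[of "P \<inter> H"] by simp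
qed

lemma aff_dim_figure:
  assumes "0 < aff_dim P" shows "aff_dim (P \<inter> H) = aff_dim P - 1"
proof (rule aff_dim_face_figure)
  show "P face_of P" using polytope by (simp add: face_of_refl polytope_imp_convex)
  show "v \<in> P" using vertex vertices_subset[of P] by blast
  show "P \<noteq> {v}" using assms by auto
qed

end

lemma vertex_figure_exists:
  assumes "polytope P" "v \<in> vertices P"
  obtains a b where "vertex_figure P v a b"
  using vertex_separation[OF assms] assms by (metis vertex_figure.intro)

text \<open>The vertex figure of a polygon is a segment, and its two ends are the slices of the
  edges at \<open>v\<close>.\<close>

lemma card_polygon_edges_at_vertex:
  assumes P: "polytope P" "aff_dim P = 2" and v: "v \<in> vertices P"
  shows "card {e \<in> edges P. v \<in> e} = 2"
proof -
  obtain a b where "vertex_figure P v a b" using vertex_figure_exists P v by blast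
  then interpret vertex_figure P v a b .
  show ?thesis
    using card_edges_at card_vertices_dim1[OF polytope_figure] aff_dim_figure P by simp
qed

lemma card_edges_at_vertex_ge_3:
  assumes P: "polytope P" "aff_dim P = 3" and v: "v \<in> vertices P"
  shows "3 \<le> card {e \<in> edges P. v \<in> e}"
proof -
  obtain a b where "vertex_figure P v a b" using vertex_figure_exists P v by blast
  then interpret vertex_figure P v a b .
  show ?thesis
    using card_edges_at card_vertices_gt_aff_dim[OF polytope_figure] aff_dim_figure P by simp
qed

text \<open>In the figure at an end of \<open>e\<close>, the edge becomes a vertex \<open>w\<close>
  of a polygon, and the 2-faces on \<open>e\<close> become the two polygon edges at
  \<open>w\<close>.\<close>

lemma card_two_faces_above:
  assumes P: "polytope P" "aff_dim P = 3" and e: "e \<in> edges P"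
  shows "card (two_faces_above P e) = 2"
proof -
  note eD = edgesD[OF e]
  have "e \<noteq> {}" using eD by auto
  then obtain v where v: "v \<in> vertices P" "v \<in> e"
    using ex_vertex_in_face P eD by blast
  obtain a b where "vertex_figure P v a b" using vertex_figure_exists P v by blast
  then interpret vertex_figure P v a b .
  have "e \<noteq> {v}" using eD by auto
  then have "aff_dim (e \<inter> H) = 0" using aff_dim_face_figure eD v by simp
  then obtain w where w: "e \<inter> H = {w}" using aff_dim_eq_0 by blast
  then have "w \<in> vertices (P \<inter> H)"
    using face_figure_face_of[OF eD(1)] by (simp add: vertices_def face_of_singleton)
  then have "card {K \<in> edges (P \<inter> H). w \<in> K} = 2"
    using card_polygon_edges_at_vertex[OF polytope_figure] aff_dim_figure P by simp
  moreover have "{K \<in> edges (P \<inter> H). w \<in> K} = {K. K face_of (P \<inter> H) \<and> aff_dim K = 1 \<and> e \<inter> H \<subseteq> K}"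
    by (auto simp: edges_def edge_of_def w)
  moreover have "two_faces_above P e = {G. G face_of P \<and> aff_dim G = 1 + 1 \<and> e \<subseteq> G}"
    by (auto simp: two_faces_above_def two_faces_def)
  ultimately show ?thesis using card_figure[OF eD(1) v(2), of 1] by simp
qed

lemma double_count:
  assumes "finite A" "finite B"
  shows "(\<Sum>x\<in>A. card {y \<in> B. R x y}) = (\<Sum>y\<in>B. card {x \<in> A. R x y})"
  using sum.swap_restrict[OF assms, of "\<lambda>_ _. 1::nat" R] assms by simp

text \<open>Incidences are counted twice: each edge has two vertices and each vertex lies on two
  edges.\<close>

lemma card_polygon_edges:
  fixes P :: "'a::euclidean_space set"
  assumes P: "polytope P" "aff_dim P = 2"
  shows "card (edges P) = card (vertices P)"
proof -
  have "(\<Sum>e\<in>edges P. card {v \<in> vertices P. v \<in> e}) = (\<Sum>v\<in>vertices P. card {e \<in> edges P. v \<in> e})"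
    by (rule double_count) (simp_all add: P finite_edges finite_vertices)
  moreover have "card {v \<in> vertices P. v \<in> e} = 2" if "e \<in> edges P" for e
  proof -
    have "{v \<in> vertices P. v \<in> e} = vertices e" using vertices_edge[OF that] by blast
    then show ?thesis using card_vertices_edge P that by simp
  qed
  ultimately show ?thesis using card_polygon_edges_at_vertex[OF P] by simp
qed

lemma card_polygon_edges_ge_3:
  fixes P :: "'a::euclidean_space set"
  assumes "polytope P" "aff_dim P = 2"
  shows "3 \<le> card (edges P)"
  using card_polygon_edges[OF assms] card_vertices_gt_aff_dim[OF assms(1)] assms(2) by simp

section \<open>Euler's inequality\<close>

text \<open>The functionals that fail to separate a given pair \<open>u, w\<close> form the
  hyperplane orthogonal to \<open>u - w\<close>; finitely many such null sets do not cover the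
  space.\<close>

lemma generic_functional_exists:
  fixes S :: "'a::euclidean_space set"
  assumes "finite S"
  obtains c where "inj_on ((\<bullet>) c) S"
proof -
  let ?N = "\<Union>(u, w) \<in> {(u, w) \<in> S \<times> S. u \<noteq> w}. {x. (u - w) \<bullet> x = 0}"
  have "finite {(u, w) \<in> S \<times> S. u \<noteq> w}"
    by (rule finite_subset[of _ "S \<times> S"]) (use assms in auto)
  then have "negligible ?N"
    by (intro negligible_Union) (auto intro!: negligible_hyperplane)
  then have "?N \<noteq> UNIV" using non_negligible_UNIV by metis
  then obtain c where "c \<notin> ?N" by blast
  then have "inj_on ((\<bullet>) c) S"
    by (fastforce simp: inj_on_def inner_diff_left inner_commute[of c])
  then show ?thesis using that by blast
qed

definition lowest_at :: "'a::euclidean_space \<Rightarrow> 'a \<Rightarrow> 'a set \<Rightarrow> bool" where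
  "lowest_at c v F \<longleftrightarrow> v \<in> F \<and> (\<forall>x\<in>F. c \<bullet> v \<le> c \<bullet> x)"

lemma lowest_vertex_exists:
  fixes P :: "'a::euclidean_space set"
  assumes P: "polytope P" "P \<noteq> {}"
  obtains v where "v \<in> vertices P" "lowest_at c v P"
proof -
  have "vertices P \<noteq> {}" using polytope_eq_convex_hull_vertices[OF P(1)] P(2) by auto
  then obtain v where v: "v \<in> vertices P" "\<forall>w \<in> vertices P. c \<bullet> v \<le> c \<bullet> w"
    using ex_min_if_finite[of "(\<bullet>) c ` vertices P"] finite_vertices[OF P(1)]
    by (auto simp: not_less)
  then have "P \<subseteq> {x. (- c) \<bullet> x \<le> - (c \<bullet> v)}"
    by (subst polytope_subset_halfspace_iff[OF P(1)]) auto
  then have "lowest_at c v P" using v(1) vertices_subset[of P] by (auto simp: lowest_at_def)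
  then show ?thesis using that v by blast
qed

text \<open>Genericity makes the lowest vertex unique. The cardinality form is what the double count
  over faces sums.\<close>

lemma card_lowest_vertices:
  fixes P :: "'a::euclidean_space set"
  assumes P: "polytope P" and c: "inj_on ((\<bullet>) c) (vertices P)" and F: "F face_of P" "F \<noteq> {}"
  shows "card {v \<in> vertices P. lowest_at c v F} = 1"
proof -
  have "polytope F" using face_of_polytope_polytope P F by blast
  then obtain v where v: "v \<in> vertices F" "lowest_at c v F"
    using lowest_vertex_exists F by blast
  have "w = v" if "w \<in> vertices P" "lowest_at c w F" for w
    using that v c vertices_face[OF F(1)] unfolding lowest_at_def
    by (metis IntD1 antisym inj_onD)
  then have "{v \<in> vertices P. lowest_at c v F} = {v}"
    using v vertices_face[OF F(1)] by blast
  then show ?thesis by simp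
qed

text \<open>This is the improvement step of the simplex method. The functional exceeds its value at
  \<open>v\<close> somewhere on the vertex figure, hence at a vertex \<open>q\<close> of it, and
  \<open>q\<close> is the slice of an edge that rises from \<open>v\<close>.\<close>

lemma ex_increasing_edge:
  fixes P :: "'a::euclidean_space set"
  assumes P: "polytope P" and v: "v \<in> vertices P" and x: "x \<in> P" "c \<bullet> v < c \<bullet> x"
  obtains e where "e \<in> edges P" "lowest_at c v e"
proof -
  obtain a b where "vertex_figure P v a b" using vertex_figure_exists P v by blast
  then interpret vertex_figure P v a b .
  have "\<not> vertices P \<subseteq> {x. c \<bullet> x \<le> c \<bullet> v}"
    using polytope_subset_halfspace_iff[OF P, of c "c \<bullet> v"] x by force
  then obtain w where w: "w \<in> vertices P" "c \<bullet> v < c \<bullet> w" by force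
  \<comment> \<open>The segment from \<open>v\<close> to the higher vertex \<open>w\<close> crosses
    \<open>H\<close> at a point \<open>z\<close> other than \<open>v\<close>, which is therefore
    still higher than \<open>v\<close>.\<close>
  then have "a \<bullet> w < b" using below by blast
  then obtain z where z: "z \<in> closed_segment v w" "a \<bullet> z = b"
    using connected_ivt_hyperplane[of "closed_segment v w" w v a b] above by force
  have "z \<in> P"
    using z v w vertices_subset[of P] polytope_imp_convex[OF P]
    by (meson closed_segment_subset subsetD)
  obtain t where t: "0 \<le> t" "z = (1 - t) *\<^sub>R v + t *\<^sub>R w"
    using z by (auto simp: in_segment)
  have "t \<noteq> 0" using t z above by auto
  moreover have "c \<bullet> z - c \<bullet> v = t * (c \<bullet> w - c \<bullet> v)"
    by (simp add: t inner_simps algebra_simps)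
  ultimately have "c \<bullet> v < c \<bullet> z" using t w by (metis diff_gt_0_iff_gt mult_pos_pos order_le_less)
  then have "\<not> vertices (P \<inter> H) \<subseteq> {x. c \<bullet> x \<le> c \<bullet> v}"
    using polytope_subset_halfspace_iff[OF polytope_figure, of c "c \<bullet> v"] z \<open>z \<in> P\<close> by force
  then obtain q where q: "q \<in> vertices (P \<inter> H)" "c \<bullet> v < c \<bullet> q" by force
  then have "{q} face_of P \<inter> H" by (simp add: vertices_def face_of_singleton)
  then obtain e where e: "e face_of P" "v \<in> e" "e \<noteq> {v}" "{q} = e \<inter> H"
    using face_figure_surj by blast
  then have "aff_dim e = 1" using aff_dim_face_figure[of e] by (metis aff_dim_sing diff_eq_eq add_0)
  then have edge: "e \<in> edges P" using e by (simp add: edges_def edge_of_def)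
  have pe: "polytope e" using face_of_polytope_polytope P e by blast
  obtain u where u: "vertices e = {v, u}"
  proof -
    have "v \<in> vertices e" using vertices_edge[OF edge] v e by blast
    then show ?thesis using card_vertices_edge[OF P edge] that
      by (metis card_2_iff insert_iff doubleton_eq_iff singletonD)
  qed
  have "q \<in> e" using e by blast
  \<comment> \<open>If the other end \<open>u\<close> were not above \<open>v\<close>, no point of
    \<open>e\<close> would be, against the choice of \<open>q\<close>.\<close>
  then have "c \<bullet> v < c \<bullet> u"
    using polytope_subset_halfspace_iff[OF pe, of c "c \<bullet> v"] u q by force
  then have "e \<subseteq> {x. (- c) \<bullet> x \<le> - (c \<bullet> v)}"
    by (subst polytope_subset_halfspace_iff[OF pe]) (auto simp: u)
  then have "lowest_at c v e" using e by (auto simp: lowest_at_def)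
  with edge show ?thesis using that by blast
qed

text \<open>The face is found by slicing \<^term>\<open>P\<close> with the level set of the functional through the
  vertex: by genericity an edge of this polygon is the slice of a 2-face.\<close>

lemma ex_two_face_crossing_level:
  fixes P :: "'a::euclidean_space set"
  assumes P: "polytope P" "aff_dim P = 3" and c: "inj_on ((\<bullet>) c) (vertices P)"
    and v: "v \<in> vertices P" and u: "u \<in> P" "c \<bullet> u < c \<bullet> v" and w: "w \<in> P" "c \<bullet> v < c \<bullet> w"
  obtains F x y where "F \<in> two_faces P" "v \<in> F" "x \<in> F" "c \<bullet> x < c \<bullet> v" "y \<in> F" "c \<bullet> v < c \<bullet> y"
proof -
  define L where "L = {x. c \<bullet> x = c \<bullet> v}"
  define R where "R = P \<inter> L"
  have L: "affine L" "convex L" by (simp_all add: L_def affine_hyperplane convex_hyperplane)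
  have R: "polytope R"
    unfolding R_def L_def using P by (simp add: polytope_Int_polyhedron polyhedron_hyperplane)
  \<comment> \<open>\<open>P\<close> has points strictly on both sides of \<open>L\<close>, so the
    slice loses exactly one dimension and is a polygon, with \<open>v\<close> still extreme.\<close>
  have "aff_dim R = 2"
    using aff_dim_slice[OF rel_interior_meets_hyperplane[OF _ u w]] u P
    by (force simp: R_def L_def polytope_imp_convex)
  moreover have "v \<in> vertices R"
    using v by (auto simp: R_def L_def vertices_def extreme_point_of_def)
  ultimately have "{e \<in> edges R. v \<in> e} \<noteq> {}"
    using card_polygon_edges_at_vertex[OF R] by (metis card.empty zero_neq_numeral)
  then obtain e where e: "e face_of R" "aff_dim e = 1" "v \<in> e" using edgesD by blast
  then obtain r where r: "r \<in> rel_interior e"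
    using rel_interior_eq_empty face_of_imp_convex by blast
  then have rR: "r \<in> R" using e rel_interior_subset face_of_imp_subset by blast
  \<comment> \<open>As for vertex figures, the face of \<open>P\<close> with \<open>r\<close> in its
    relative interior has \<open>e\<close> as its slice.\<close>
  then obtain F where F: "F face_of P" "r \<in> rel_interior F"
    using rel_interior_of_face_exists P R_def by blast
  have pF: "polytope F" using face_of_polytope_polytope P F by blast
  have "rel_interior (F \<inter> L) = rel_interior F \<inter> L"
    using F rR pF L by (intro convex_affine_rel_interior_Int) (auto simp: R_def polytope_imp_convex)
  moreover have "F \<inter> L face_of R" using F L by (simp add: R_def face_of_slice)
  ultimately have eF: "e = F \<inter> L"
    using face_of_eq[OF e(1), of "F \<inter> L"] r rR F by (auto simp: R_def)
  \<comment> \<open>Otherwise \<open>F\<close> is the edge \<open>e\<close> itself, with two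
    vertices on one level, against genericity.\<close>
  have nsub: "\<not> F \<subseteq> L"
  proof
    assume "F \<subseteq> L"
    then have "F = e" using eF by blast
    then have "card (vertices F) = 2" using card_vertices_dim1 pF e by blast
    then obtain p q where pq: "p \<in> vertices F" "q \<in> vertices F" "p \<noteq> q"
      by (metis card_2_iff insertCI)
    then have "p \<in> L" "q \<in> L" using vertices_subset[of F] \<open>F \<subseteq> L\<close> by auto
    then have "c \<bullet> p = c \<bullet> q" by (simp add: L_def)
    then show False using pq c vertices_face[OF F(1)] by (metis IntD1 inj_onD)
  qed
  have "aff_dim e = aff_dim F - 1"
    unfolding eF L_def by (rule aff_dim_slice) (use F rR nsub in \<open>auto simp: R_def L_def\<close>)
  then have "F \<in> two_faces P" using e F by (simp add: two_faces_def)
  moreover have "v \<in> F" using e eF by blast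
  moreover have meets: "(F \<inter> L) \<inter> rel_interior F \<noteq> {}"
    using F rR rel_interior_subset by (auto simp: R_def)
  \<comment> \<open>If \<open>F\<close> stayed on one side of \<open>L\<close>, then
    \<open>F \<inter> L\<close> would be a face of \<open>F\<close> meeting its relative interior,
    hence all of \<open>F\<close>.\<close>
  have "\<exists>x\<in>F. c \<bullet> x < c \<bullet> v"
  proof (rule ccontr)
    assume "\<not> ?thesis"
    then have "F \<inter> L face_of F"
      unfolding L_def using pF
      by (intro face_of_Int_supporting_hyperplane_ge) (auto simp: polytope_imp_convex not_less)
    then show False using subset_of_face_of[of "F \<inter> L" F F] meets nsub by blast
  qed
  moreover have "\<exists>x\<in>F. c \<bullet> v < c \<bullet> x"
  proof (rule ccontr)
    assume "\<not> ?thesis"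
    then have "F \<inter> L face_of F"
      unfolding L_def using pF
      by (intro face_of_Int_supporting_hyperplane_le) (auto simp: polytope_imp_convex not_less)
    then show False using subset_of_face_of[of "F \<inter> L" F F] meets nsub by blast
  qed
  ultimately show ?thesis using that by blast
qed

definition low_edges :: "'a::euclidean_space set \<Rightarrow> 'a \<Rightarrow> 'a \<Rightarrow> 'a set set" where
  "low_edges P c v = {e \<in> edges P. lowest_at c v e}"

definition low_two_faces :: "'a::euclidean_space set \<Rightarrow> 'a \<Rightarrow> 'a \<Rightarrow> 'a set set" where
  "low_two_faces P c v = {F \<in> two_faces P. lowest_at c v F}"

text \<open>Each low edge at \<^term>\<open>v\<close> lies in two 2-faces and each low 2-face contains two low edges at
  \<^term>\<open>v\<close>. If \<^term>\<open>v\<close> is not extremal, then some 2-face that is not low contributes one more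
  incidence, and parity gives the strict inequality.\<close>

lemma card_low_two_faces_le:
  fixes P :: "'a::euclidean_space set"
  assumes P: "polytope P" "aff_dim P = 3" and c: "inj_on ((\<bullet>) c) (vertices P)"
    and v: "v \<in> vertices P"
  shows "card (low_two_faces P c v) +
           (if (\<exists>u\<in>P. c \<bullet> u < c \<bullet> v) \<and> (\<exists>w\<in>P. c \<bullet> v < c \<bullet> w) then 1 else 0)
         \<le> card (low_edges P c v)"
proof -
  let ?U = "low_edges P c v" and ?W = "low_two_faces P c v"
  let ?n = "\<lambda>F. card {e \<in> ?U. e \<subseteq> F}"
  have fin: "finite ?U" "finite ?W" "finite (two_faces P)"
    using P by (simp_all add: low_edges_def low_two_faces_def finite_edges finite_two_faces)
  have pF: "polytope F" "aff_dim F = 2" "F face_of P" if "F \<in> two_faces P" for F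
    using that P face_of_polytope_polytope two_facesD by blast+
  have "2 * card ?U = (\<Sum>e\<in>?U. card (two_faces_above P e))"
    using card_two_faces_above[OF P] by (simp add: low_edges_def)
  also have "\<dots> = (\<Sum>F\<in>two_faces P. ?n F)"
    unfolding two_faces_above_def by (rule double_count) (use fin in auto)
  finally have total: "2 * card ?U = (\<Sum>F\<in>two_faces P. ?n F)" .
  have low: "?n F = 2" if "F \<in> ?W" for F
  proof -
    have F: "F \<in> two_faces P" "lowest_at c v F" using that by (auto simp: low_two_faces_def)
    \<comment> \<open>As \<open>v\<close> is lowest in all of \<open>F\<close>, it is lowest in
      every edge of \<open>F\<close> through it.\<close>
    then have "{e \<in> ?U. e \<subseteq> F} = {e \<in> edges F. v \<in> e}"
      using edges_face[of F P] pF by (auto simp: low_edges_def lowest_at_def)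
    moreover have "v \<in> vertices F"
      using F vertices_face[OF pF(3)] v by (auto simp: lowest_at_def)
    ultimately show ?thesis using card_polygon_edges_at_vertex pF F by metis
  qed
  have WF: "?W \<subseteq> two_faces P" by (auto simp: low_two_faces_def)
  show ?thesis
  proof (cases "(\<exists>u\<in>P. c \<bullet> u < c \<bullet> v) \<and> (\<exists>w\<in>P. c \<bullet> v < c \<bullet> w)")
    case True
    then obtain F x y where F: "F \<in> two_faces P" "v \<in> F" "x \<in> F" "c \<bullet> x < c \<bullet> v"
        and y: "y \<in> F" "c \<bullet> v < c \<bullet> y"
      using ex_two_face_crossing_level[OF P c v] by metis
    \<comment> \<open>\<open>v\<close> is not highest in the polygon \<open>F\<close>, so some edge
      of \<open>F\<close> rises from it and is low; \<open>F\<close> itself is not low because of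
      \<open>x\<close>.\<close>
    have "v \<in> vertices F" using F v vertices_face[OF pF(3)] by blast
    then obtain e where "e \<in> edges F" "lowest_at c v e"
      using ex_increasing_edge[OF pF(1)[OF F(1)] _ y] by blast
    then have "e \<in> {e \<in> ?U. e \<subseteq> F}"
      using edges_face[OF pF(3)[OF F(1)]] by (auto simp: low_edges_def)
    then have "{e \<in> ?U. e \<subseteq> F} \<noteq> {}" by blast
    then have "0 < ?n F" using fin(1) by (simp add: card_gt_0_iff)
    moreover have "F \<notin> ?W" using F by (force simp: low_two_faces_def lowest_at_def)
    ultimately have "2 * card ?W + 1 \<le> (\<Sum>F\<in>insert F ?W. ?n F)"
      using fin low by simp
    also have "\<dots> \<le> (\<Sum>F\<in>two_faces P. ?n F)"
      using fin WF F by (intro sum_mono2) auto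
    finally show ?thesis using total True by simp
  next
    case False
    have "2 * card ?W = (\<Sum>F\<in>?W. ?n F)" using low by simp
    also have "\<dots> \<le> (\<Sum>F\<in>two_faces P. ?n F)"
      using fin WF by (intro sum_mono2) auto
    finally show ?thesis unfolding if_not_P[OF False] using total by linarith
  qed
qed

section \<open>Summation over lowest vertices\<close>

lemma card_eq_sum_lowest:
  fixes P :: "'a::euclidean_space set"
  assumes P: "polytope P" and c: "inj_on ((\<bullet>) c) (vertices P)"
    and A: "finite A" "\<And>F. F \<in> A \<Longrightarrow> F face_of P \<and> F \<noteq> {}"
  shows "card A = (\<Sum>v\<in>vertices P. card {F \<in> A. lowest_at c v F})"
proof -
  have "(\<Sum>v\<in>vertices P. card {F \<in> A. lowest_at c v F})
      = (\<Sum>F\<in>A. card {v \<in> vertices P. lowest_at c v F})"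
    by (rule double_count) (simp_all add: P A finite_vertices)
  also have "\<dots> = card A"
    using card_lowest_vertices[OF P c] A by simp
  finally show ?thesis by simp
qed

text \<open>The local comparison is summed over all vertices. Its surplus of one occurs at every
  vertex except the lowest \<open>p\<close> and the highest \<open>q\<close>, which accounts for the
  constant 2.\<close>

proposition euler_inequality:
  fixes P :: "'a::euclidean_space set"
  assumes P: "polytope P" "aff_dim P = 3"
  shows "card (vertices P) + card (two_faces P) \<le> card (edges P) + 2"
proof -
  obtain c where c: "inj_on ((\<bullet>) c) (vertices P)"
    using generic_functional_exists finite_vertices P by blast
  have "P \<noteq> {}" using P by auto
  obtain p where p: "p \<in> vertices P" "lowest_at c p P"
    using lowest_vertex_exists[OF P(1) \<open>P \<noteq> {}\<close>] by blast
  \<comment> \<open>Lowest for \<open>- c\<close> means highest for \<open>c\<close>.\<close>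
  obtain q where q: "q \<in> vertices P" "lowest_at (- c) q P"
    using lowest_vertex_exists[OF P(1) \<open>P \<noteq> {}\<close>] by blast
  have fin: "finite (vertices P)" using P finite_vertices by blast
  let ?d = "\<lambda>v. if v \<in> {p, q} then 0 else (1::nat)"
  have loc: "card (low_two_faces P c v) + ?d v \<le> card (low_edges P c v)"
    if v: "v \<in> vertices P" for v
  proof (cases "v \<in> {p, q}")
    case True
    then show ?thesis using card_low_two_faces_le[OF P c v] by (simp split: if_splits)
  next
    case False
    have "c \<bullet> p \<noteq> c \<bullet> v" "c \<bullet> q \<noteq> c \<bullet> v"
      using False c p q v by (auto dest: inj_onD)
    moreover have "v \<in> P" "p \<in> P" "q \<in> P" using v p q vertices_subset[of P] by auto
    moreover from this have "c \<bullet> p \<le> c \<bullet> v" "c \<bullet> v \<le> c \<bullet> q"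
      using p q by (auto simp: lowest_at_def)
    ultimately show ?thesis
      using card_low_two_faces_le[OF P c v] False by (force split: if_splits)
  qed
  have "card (vertices P) \<le> card (vertices P - {p, q}) + 2"
    using diff_card_le_card_Diff[of "{p, q}" "vertices P"] card_insert_le_m1[of 2 "{q}" p] by simp
  also have "card (vertices P - {p, q}) = (\<Sum>v\<in>vertices P. ?d v)"
  proof -
    have "vertices P \<inter> - {v. v = p \<or> v = q} = vertices P - {p, q}" by auto
    then show ?thesis using fin by (simp add: sum.If_cases)
  qed
  finally have V: "card (vertices P) \<le> (\<Sum>v\<in>vertices P. ?d v) + 2" .
  have "card (edges P) = (\<Sum>v\<in>vertices P. card (low_edges P c v))"
    unfolding low_edges_def using P edgesD
    by (intro card_eq_sum_lowest[OF P(1) c]) (force simp: finite_edges)+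
  moreover have "card (two_faces P) = (\<Sum>v\<in>vertices P. card (low_two_faces P c v))"
    unfolding low_two_faces_def using P two_facesD
    by (intro card_eq_sum_lowest[OF P(1) c]) (force simp: finite_two_faces)+
  moreover have "(\<Sum>v\<in>vertices P. card (low_two_faces P c v) + ?d v)
      \<le> (\<Sum>v\<in>vertices P. card (low_edges P c v))"
    by (rule sum_mono) (rule loc)
  ultimately show ?thesis using V unfolding sum.distrib by linarith
qed

section \<open>Forman--Ricci curvature\<close>

abbreviation vertex_degree :: "'a::euclidean_space set \<Rightarrow> 'a \<Rightarrow> nat" where
  "vertex_degree P v \<equiv> card {e \<in> edges P. v \<in> e}"

text \<open>An edge containing both ends of \<open>e\<close> contains \<open>e\<close> as a face,
  and a proper face would have smaller dimension.\<close>

lemma edge_eq_of_vertices_subset: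
  assumes P: "polytope P" and e: "e \<in> edges P" "e' \<in> edges P" and sub: "vertices e \<subseteq> e'"
  shows "e = e'"
proof (rule ccontr)
  assume "e \<noteq> e'"
  have "vertices e \<subseteq> vertices e'"
    using sub vertices_edge[OF e(1)] vertices_edge[OF e(2)] by blast
  then have "e \<subseteq> e'"
    using face_subset_iff_vertices[OF P] edgesD e by blast
  then have "e face_of e'" using face_of_face[of e' P e] edgesD e by blast
  then have "aff_dim e < aff_dim e'"
    using face_of_aff_dim_lt[of e' e] \<open>e \<noteq> e'\<close> e edgesD face_of_imp_convex by blast
  then show False using e edgesD by (metis less_irrefl)
qed

text \<open>Distinct 2-faces meet in a face of dimension below 2; if \<open>e\<close> were a proper
  face of it, that dimension would exceed 1.\<close>

lemma edge_eq_Int_two_faces: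
  assumes P: "polytope P" and F: "F \<in> two_faces P" and G: "G \<in> two_faces P" and "F \<noteq> G"
    and e: "e \<in> edges P" "e \<subseteq> F" "e \<subseteq> G"
  shows "e = F \<inter> G"
proof (rule ccontr)
  assume neq: "e \<noteq> F \<inter> G"
  note fF = two_facesD[OF F] and fG = two_facesD[OF G] and fe = edgesD[OF e(1)]
  have conv: "convex F" "convex G" "convex (F \<inter> G)"
    using face_of_imp_convex[OF fF(1)] face_of_imp_convex[OF fG(1)] by (simp_all add: convex_Int)
  have FG: "F \<inter> G face_of P" using face_of_Int[OF fF(1) fG(1)] .
  have "F \<inter> G face_of F" "F \<inter> G face_of G"
    using FG by (simp_all add: face_of_face[OF fF(1)] face_of_face[OF fG(1)])
  moreover have "F \<inter> G \<noteq> F \<or> F \<inter> G \<noteq> G" using \<open>F \<noteq> G\<close> by blast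
  ultimately have "aff_dim (F \<inter> G) < 2"
    using face_of_aff_dim_lt[OF conv(1)] face_of_aff_dim_lt[OF conv(2)] fF(2) fG(2) by metis
  moreover have "e face_of F \<inter> G" using e fe(1) by (simp add: face_of_face[OF FG])
  then have "1 < aff_dim (F \<inter> G)"
    using face_of_aff_dim_lt[OF conv(3) _ neq] fe(2) by simp
  ultimately show False by linarith
qed

text \<open>The two pairs share \<open>x\<close>, so at most three elements are removed. In the
  application \<open>x\<close> is the edge \<open>e\<close>, and the pairs are the edges of the two
  faces at one end, or of one face at the two ends.\<close>

lemma card_Diff_Un_ge:
  assumes fin: "finite X" "finite A" "finite B" and "card A = 2" "card B = 2" "x \<in> A" "x \<in> B"
  shows "card X \<le> card (X - (A \<union> B)) + 3"
proof -
  have "A \<inter> B \<noteq> {}" using assms by blast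
  then have "0 < card (A \<inter> B)" using fin by (simp add: card_gt_0_iff)
  then have "card (A \<union> B) \<le> 3" using card_Un_Int[OF fin(2,3)] assms by simp
  moreover have "card X - card (A \<union> B) \<le> card (X - (A \<union> B))"
    using fin by (intro diff_card_le_card_Diff) simp
  ultimately show ?thesis by linarith
qed

text \<open>From the edges at each end, \<open>e\<close> and its neighbors along \<open>F\<close>
  and \<open>G\<close> are dropped; from the sides of each face, \<open>e\<close> and its two
  adjacent sides. The four remaining sets are disjoint and consist of parallel neighbors, and each
  drops at most three edges, whence 12.\<close>

lemma card_parallel_neighbors_ge:
  fixes P :: "'a::euclidean_space set"
  assumes P: "polytope P" "aff_dim P = 3" and e: "e \<in> edges P"
    and uv: "vertices e = {u, v}" and above: "two_faces_above P e = {F, G}" and "F \<noteq> G"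
  shows "vertex_degree P u + vertex_degree P v + card (edges F) + card (edges G)
           \<le> card (parallel_neighbors P e) + 12"
proof -
  define D where "D Q x = {e' \<in> edges Q. x \<in> e'}" for Q :: "'a set" and x
  \<comment> \<open>\<open>A x\<close> supplies neighbors that share the end \<open>x\<close> but no
    2-face, and \<open>B Q\<close> neighbors that share the face \<open>Q\<close> but no
    vertex.\<close>
  define A where "A x = D P x - (D F x \<union> D G x)" for x
  define B where "B Q = edges Q - (D Q u \<union> D Q v)" for Q
  have FG: "F \<in> two_faces P" "G \<in> two_faces P" "e \<subseteq> F" "e \<subseteq> G"
    using above by (auto simp: two_faces_above_def)
  note faces = two_facesD(1)[OF FG(1)] two_facesD(1)[OF FG(2)]
  note edgesFG = edges_face[OF faces(1)] edges_face[OF faces(2)]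
  have poly: "polytope F" "polytope G" using P faces face_of_polytope_polytope by blast+
  have uv_in: "x \<in> vertices P" "x \<in> e" if "x \<in> {u, v}" for x
    using vertices_edge[OF e] uv that by auto
  have fin: "finite (edges P)" "finite (edges F)" "finite (edges G)"
    using P poly by (simp_all add: finite_edges)
  then have finD: "finite (D Q x)" if "Q \<in> {P, F, G}" for Q x using that by (auto simp: D_def)
  have eD: "e \<in> D F x" "e \<in> D G x" if "x \<in> {u, v}" for x
    using that FG e uv_in by (auto simp: D_def edgesFG)
  have cD: "card (D Q x) = 2" if "x \<in> {u, v}" "Q \<in> {F, G}" for Q x
  proof -
    have Q: "Q \<in> two_faces P" "e \<subseteq> Q" using FG that by auto
    then have "x \<in> vertices Q"
      using uv_in[OF that(1)] by (auto simp: vertices_face[OF two_facesD(1)])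
    then show ?thesis
      using card_polygon_edges_at_vertex[of Q x] poly that two_facesD(2)[OF Q(1)]
      by (auto simp: D_def)
  qed
  have "card (D P x) \<le> card (A x) + 3" if "x \<in> {u, v}" for x
    unfolding A_def using that eD cD finD by (intro card_Diff_Un_ge[of _ _ _ e]) auto
  then have cA: "vertex_degree P u \<le> card (A u) + 3" "vertex_degree P v \<le> card (A v) + 3"
    by (auto simp: D_def)
  have "card (edges Q) \<le> card (B Q) + 3" if "Q \<in> {F, G}" for Q
    unfolding B_def using that eD cD finD fin by (intro card_Diff_Un_ge[of _ _ _ e]) auto
  then have cB: "card (edges F) \<le> card (B F) + 3" "card (edges G) \<le> card (B G) + 3"
    by auto
  have AN: "A x \<subseteq> parallel_neighbors P e" if x: "x \<in> {u, v}" for x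
  proof
    fix e' assume "e' \<in> A x"
    then have e': "e' \<in> edges P" "x \<in> e'" "e' \<notin> D F x" "e' \<notin> D G x" by (auto simp: A_def D_def)
    then have "e' \<noteq> e" using eD x by blast
    have "\<not> e' \<subseteq> F" "\<not> e' \<subseteq> G" using e' by (auto simp: D_def edgesFG)
    \<comment> \<open>\<open>F\<close> and \<open>G\<close> are the only candidates for a 2-face
      common to \<open>e\<close> and \<open>e'\<close>.\<close>
    moreover have "Q \<in> {F, G}" if "Q \<in> two_faces P" "e \<subseteq> Q" for Q
      using that unfolding above[symmetric] two_faces_above_def by simp
    ultimately have "\<not> in_common_two_face P e e'"
      unfolding in_common_two_face_def by blast
    moreover have "x \<in> vertices e \<inter> vertices e'"
      using uv_in[OF x] e'(2) by (simp add: vertices_edge[OF e'(1)] vertices_edge[OF e])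
    ultimately show "e' \<in> parallel_neighbors P e"
      using e'(1) \<open>e' \<noteq> e\<close> unfolding parallel_neighbors_def by blast
  qed
  have BN: "B Q \<subseteq> parallel_neighbors P e" if Q: "Q \<in> {F, G}" for Q
  proof
    fix e' assume "e' \<in> B Q"
    then have e': "e' \<in> edges Q" "u \<notin> e'" "v \<notin> e'" by (auto simp: B_def D_def)
    have Q2: "Q \<in> two_faces P" "e \<subseteq> Q" using Q FG by auto
    then have "e' \<in> edges P" "e' \<subseteq> Q" using e' edges_face[OF two_facesD(1)[OF Q2(1)]] by blast+
    moreover have "e' \<noteq> e" using e' uv_in by blast
    moreover have "vertices e \<inter> vertices e' = {}"
      using e' uv vertices_subset[of e'] by auto
    moreover have "in_common_two_face P e e'"
      using Q2 \<open>e' \<subseteq> Q\<close> by (auto simp: in_common_two_face_def)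
    ultimately show "e' \<in> parallel_neighbors P e" unfolding parallel_neighbors_def by blast
  qed
  have "A u \<inter> A v = {}"
  proof -
    have "e' = e" if "e' \<in> edges P" "u \<in> e'" "v \<in> e'" for e'
      using edge_eq_of_vertices_subset[OF P(1) e] that uv by auto
    then show ?thesis using eD by (auto simp: A_def D_def)
  qed
  moreover have "B F \<inter> B G = {}"
  proof -
    note Int = edge_eq_Int_two_faces[OF P(1) FG(1,2) \<open>F \<noteq> G\<close>]
    have "e' = e" if "e' \<in> edges F" "e' \<in> edges G" for e'
      using Int[of e'] Int[OF e FG(3,4)] that by (simp add: edgesFG)
    then show ?thesis using eD by (auto simp: B_def)
  qed
  \<comment> \<open>Edges in the first union contain \<open>u\<close> or \<open>v\<close>, those in
    the second contain neither.\<close>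
  moreover have "(A u \<union> A v) \<inter> (B F \<union> B G) = {}" by (auto simp: A_def B_def D_def)
  moreover have finAB: "finite (A x)" "finite (B F)" "finite (B G)" for x
    using fin finD by (auto simp: A_def B_def)
  ultimately have "card (A u \<union> A v \<union> (B F \<union> B G)) = card (A u) + card (A v) + (card (B F) + card (B G))"
    by (simp add: card_Un_disjoint)
  moreover have "card (A u \<union> A v \<union> (B F \<union> B G)) \<le> card (parallel_neighbors P e)"
    using AN BN fin by (intro card_mono) (auto simp: parallel_neighbors_def)
  ultimately show ?thesis using cA cB by linarith
qed

text \<open>The left side is the chord of \<open>1 / k\<close> through \<open>k = m\<close> and
  \<open>k = m + 1\<close>. It lies below the convex curve at every positive integer because
  \<open>(k - m) * (k - m - 1)\<close> is never negative there.\<close>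

lemma inverse_ge_chord:
  fixes k m :: nat
  assumes "0 < k" "0 < m"
  shows "(2 * real m + 1 - real k) / (real m * (real m + 1)) \<le> 1 / real k"
proof -
  have "0 \<le> (int k - int m) * (int k - int m - 1)"
    by (cases "int k \<le> int m") (auto intro: mult_nonpos_nonpos mult_nonneg_nonneg)
  then have "0 \<le> real_of_int ((int k - int m) * (int k - int m - 1))" by linarith
  then have "(2 * real m + 1 - real k) * real k \<le> real m * (real m + 1)"
    by (simp add: algebra_simps)
  then show ?thesis using assms by (simp add: divide_simps mult.commute)
qed

text \<open>The factor 7 is the best possible: there is equality for $(p, q, f, g) = (3, 4, 4, 4)$.\<close>

lemma edge_weight_bound:
  fixes p q f g :: nat
  assumes "3 \<le> p" "3 \<le> q" "3 \<le> f" "3 \<le> g" and "p + q + f + g \<le> 15"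
  shows "1 / real p + 1 / real q \<le> 7 * (1 / real p + 1 / real q + (1 / real f + 1 / real g) - 1)"
proof (cases "f + g \<le> 8")
  case True
  \<comment> \<open>Chord through 3 and 4. The claim amounts to
    \<open>6 * (1/p + 1/q) + 7 * (1/f + 1/g) \<ge> 7\<close>; with total at most 15 these chords
    bound the left side below by \<open>(92 - (f + g)) / 12\<close>, which is at least 7 for
    \<open>f + g \<le> 8\<close>.\<close>
  have "(7 - real k) / 12 \<le> 1 / real k" if "3 \<le> k" for k :: nat
    using inverse_ge_chord[of k 3] that by simp
  from this[of p] this[of q] this[of f] this[of g] have
    "(14 - real (p + q)) / 12 \<le> 1 / real p + 1 / real q"
    "(14 - real (f + g)) / 12 \<le> 1 / real f + 1 / real g"
    using assms by simp_all
  moreover have "real (p + q) + real (f + g) \<le> 15" "real (f + g) \<le> 8"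
    using True assms by linarith+
  ultimately show ?thesis by argo
next
  case False
  then have "p = 3" "q = 3" "f + g = 9" using assms by linarith+
  \<comment> \<open>Here \<open>1/f + 1/g \<ge> 3/7\<close> is required. The chord through 3 and 4
    gives only 5/12, the one through 4 and 5 gives 9/20.\<close>
  have "(9 - real k) / 20 \<le> 1 / real k" if "3 \<le> k" for k :: nat
    using inverse_ge_chord[of k 4] that by simp
  from this[of f] this[of g] have "(18 - real (f + g)) / 20 \<le> 1 / real f + 1 / real g"
    using assms by simp
  then show ?thesis using \<open>p = 3\<close> \<open>q = 3\<close> \<open>f + g = 9\<close> by simp
qed

text \<open>Every \<open>y\<close> spreads a unit weight evenly over the \<open>x\<close> related to
  it. Nonempty fibres matter: an empty one would contribute 0 instead of 1.\<close>

lemma sum_inverse_card: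
  assumes "finite A" "finite B" and "\<And>y. y \<in> B \<Longrightarrow> {x \<in> A. R x y} \<noteq> {}"
  shows "(\<Sum>x\<in>A. \<Sum>y\<in>{y \<in> B. R x y}. 1 / real (card {x \<in> A. R x y})) = real (card B)"
proof -
  have "(\<Sum>x\<in>A. \<Sum>y\<in>{y \<in> B. R x y}. 1 / real (card {x \<in> A. R x y}))
      = (\<Sum>y\<in>B. \<Sum>x\<in>{x \<in> A. R x y}. 1 / real (card {x \<in> A. R x y}))"
    using assms by (intro sum.swap_restrict)
  also have "\<dots> = (\<Sum>y\<in>B. 1)"
    using assms by (intro sum.cong refl) (simp add: card_gt_0_iff)
  finally show ?thesis by simp
qed

proposition card_vertices_le_14:
  fixes P :: "'a::euclidean_space set"
  assumes P: "polytope P" "aff_dim P = 3" and pos: "forman_ricci_positive P"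
  shows "card (vertices P) \<le> 14"
proof -
  note fin = finite_edges[OF P(1)] finite_two_faces[OF P(1)] finite_vertices[OF P(1)]
  \<comment> \<open>\<open>?p e\<close> is \<open>1/p + 1/q\<close> for the ends of
    \<open>e\<close>, and \<open>?f e\<close> is \<open>1/f + 1/g\<close> for its faces. Written as
    sums over incidences, they total V and F over all edges.\<close>
  let ?p = "\<lambda>e. \<Sum>x\<in>{x \<in> vertices P. x \<in> e}. 1 / real (vertex_degree P x)"
  let ?f = "\<lambda>e. \<Sum>F\<in>{F \<in> two_faces P. e \<subseteq> F}. 1 / real (card {e \<in> edges P. e \<subseteq> F})"
  have deg: "3 \<le> vertex_degree P x" if "x \<in> vertices P" for x
    using card_edges_at_vertex_ge_3[OF P that] .
  have gon: "3 \<le> card {e \<in> edges P. e \<subseteq> F}" if "F \<in> two_faces P" for F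
    using card_polygon_edges_ge_3[of F] two_facesD[OF that] P face_of_polytope_polytope edges_face
    by metis
  have ne: "{e \<in> edges P. x \<in> e} \<noteq> {}" if "x \<in> vertices P" for x
    using deg[OF that] by (metis card.empty not_numeral_le_zero)
  have ne': "{e \<in> edges P. e \<subseteq> F} \<noteq> {}" if "F \<in> two_faces P" for F
    using gon[OF that] by (metis card.empty not_numeral_le_zero)
  have V: "(\<Sum>e\<in>edges P. ?p e) = real (card (vertices P))"
    by (rule sum_inverse_card) (use fin ne in simp_all)
  have F: "(\<Sum>e\<in>edges P. ?f e) = real (card (two_faces P))"
    by (rule sum_inverse_card) (use fin ne' in simp_all)
  have "?p e \<le> 7 * (?p e + ?f e - 1)" if e: "e \<in> edges P" for e
  proof -
    obtain u v where uv: "vertices e = {u, v}" "u \<noteq> v"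
      using card_vertices_edge[OF P(1) e] by (auto simp: card_2_iff)
    obtain F G where FG: "two_faces_above P e = {F, G}" "F \<noteq> G"
      using card_two_faces_above[OF P e] by (auto simp: card_2_iff)
    have uvP: "{x \<in> vertices P. x \<in> e} = {u, v}" using vertices_edge[OF e] uv by blast
    then have uvV: "u \<in> vertices P" "v \<in> vertices P" by blast+
    have FGP: "{F \<in> two_faces P. e \<subseteq> F} = {F, G}" using FG by (simp add: two_faces_above_def)
    then have FGt: "F \<in> two_faces P" "G \<in> two_faces P" by blast+
    have "0 < forman_ricci P e"
      using pos e by (simp add: forman_ricci_positive_def)
    \<comment> \<open>The curvature is \<open>2 + 2\<close> minus this cardinality. At most three
      neighbors remain, and \<open>3 + 12 = 15\<close> bounds the sum of degrees and face
      sizes.\<close>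
    then have "card (parallel_neighbors P e) < 4"
      by (simp add: forman_ricci_def card_two_faces_above[OF P e])
    then have "vertex_degree P u + vertex_degree P v + card {e \<in> edges P. e \<subseteq> F} + card {e \<in> edges P. e \<subseteq> G} \<le> 15"
      using card_parallel_neighbors_ge[OF P e uv(1) FG]
      unfolding FGt[THEN two_facesD(1), THEN edges_face] by linarith
    then have "1 / real (vertex_degree P u) + 1 / real (vertex_degree P v)
        \<le> 7 * (1 / real (vertex_degree P u) + 1 / real (vertex_degree P v)
          + (1 / real (card {e \<in> edges P. e \<subseteq> F}) + 1 / real (card {e \<in> edges P. e \<subseteq> G})) - 1)"
      by (rule edge_weight_bound[OF deg[OF uvV(1)] deg[OF uvV(2)] gon[OF FGt(1)] gon[OF FGt(2)]])
    moreover have "?p e = 1 / real (vertex_degree P u) + 1 / real (vertex_degree P v)"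
      unfolding uvP using uv(2) by simp
    moreover have "?f e = 1 / real (card {e \<in> edges P. e \<subseteq> F}) + 1 / real (card {e \<in> edges P. e \<subseteq> G})"
      unfolding FGP using FG(2) by simp
    ultimately show ?thesis by (simp only:)
  qed
  then have "(\<Sum>e\<in>edges P. ?p e) \<le> (\<Sum>e\<in>edges P. 7 * (?p e + ?f e - 1))"
    by (rule sum_mono)
  also have "\<dots> = 7 * ((\<Sum>e\<in>edges P. ?p e) + (\<Sum>e\<in>edges P. ?f e) - real (card (edges P)))"
    by (simp add: sum_subtractf sum.distrib flip: sum_distrib_left)
  finally have "real (card (vertices P))
      \<le> 7 * (real (card (vertices P)) + real (card (two_faces P)) - real (card (edges P)))"
    by (simp only: V F)
  moreover have "real (card (vertices P)) + real (card (two_faces P)) \<le> real (card (edges P)) + 2"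
    using euler_inequality[OF P] by linarith
  \<comment> \<open>V is at most 7 times V - E + F, which Euler's inequality bounds by 2.\<close>
  ultimately have "real (card (vertices P)) \<le> 14" by argo
  then show ?thesis by simp
qed

section \<open>Combinatorial types\<close>

text \<open>A labelling of the vertices carries the face lattice to a family of label sets ordered
  by inclusion, so polytopes in different positions can be compared and a bounded label set leaves
  finitely many codes.\<close>

definition face_code :: "('a::euclidean_space \<Rightarrow> nat) \<Rightarrow> 'a set \<Rightarrow> nat set set" where
  "face_code g P = (\<lambda>F. g ` vertices F) ` {F. F face_of P}"

lemma image_vertices_subset_iff:
  assumes P: "polytope P" and g: "inj_on g (vertices P)" and F: "F face_of P" and G: "G face_of P"
  shows "g ` vertices F \<subseteq> g ` vertices G \<longleftrightarrow> F \<subseteq> G"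
proof -
  have "vertices F \<subseteq> vertices P" "vertices G \<subseteq> vertices P"
    using vertices_face[OF F] vertices_face[OF G] by auto
  then have "g ` vertices F \<subseteq> g ` vertices G \<longleftrightarrow> vertices F \<subseteq> vertices G"
    by (rule inj_on_image_subset_iff[OF g])
  then show ?thesis using face_subset_iff_vertices[OF P F G] by blast
qed

lemma bij_betw_face_code:
  assumes P: "polytope P" and g: "inj_on g (vertices P)"
  shows "bij_betw (\<lambda>F. g ` vertices F) {F. F face_of P} (face_code g P)"
proof -
  have "inj_on (\<lambda>F. g ` vertices F) {F. F face_of P}"
    by (rule inj_onI) (metis P g image_vertices_subset_iff mem_Collect_eq order_refl subset_antisym)
  then show ?thesis by (simp add: bij_betw_def face_code_def)
qed

text \<open>Both face lattices are isomorphic to the common code ordered by inclusion; the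
  equivalence is one isomorphism followed by the inverse of the other.\<close>

lemma combinatorially_equivalent_if_face_code_eq:
  assumes P: "polytope P" and g: "inj_on g (vertices P)"
    and Q: "polytope Q" and h: "inj_on h (vertices Q)"
    and eq: "face_code g P = face_code h Q"
  shows "combinatorially_equivalent P Q"
proof -
  let ?k = "inv_into {F. F face_of Q} (\<lambda>F. h ` vertices F)"
  define f where "f = ?k \<circ> (\<lambda>F. g ` vertices F)"
  note bP = bij_betw_face_code[OF P g] and bQ = bij_betw_face_code[OF Q h]
  have b: "bij_betw f {F. F face_of P} {F. F face_of Q}"
    unfolding f_def using bij_betw_trans[OF bP] bij_betw_inv_into[OF bQ] eq by metis
  have hf: "h ` vertices (f F) = g ` vertices F" if "F face_of P" for F
  proof -
    have "g ` vertices F \<in> face_code h Q" using that eq[symmetric] by (simp add: face_code_def)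
    then show ?thesis using bij_betw_inv_into_right[OF bQ] by (simp add: f_def)
  qed
  have "F \<subseteq> F' \<longleftrightarrow> f F \<subseteq> f F'" if F: "F face_of P" "F' face_of P" for F F'
  proof -
    have "f F face_of Q" "f F' face_of Q" using bij_betwE[OF b] F by auto
    then have "f F \<subseteq> f F' \<longleftrightarrow> h ` vertices (f F) \<subseteq> h ` vertices (f F')"
      using image_vertices_subset_iff[OF Q h] by blast
    also have "\<dots> \<longleftrightarrow> F \<subseteq> F'" using image_vertices_subset_iff[OF P g F] hf F by simp
    finally show ?thesis by blast
  qed
  then show ?thesis using b unfolding combinatorially_equivalent_def by blast
qed

text \<open>With labels below \<open>n\<close>, all codes lie in the finite set
  \<open>Pow (Pow {..<n})\<close>, and the code determines the class.\<close>

proposition finite_combinatorial_types: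
  fixes S :: "'a::euclidean_space set set"
  assumes S: "\<And>P. P \<in> S \<Longrightarrow> polytope P \<and> card (vertices P) \<le> n"
  shows "finite (S // comb_equiv_rel)"
proof -
  have "\<exists>g. inj_on g (vertices P) \<and> g ` vertices P \<subseteq> {..<n}" if "P \<in> S" for P
  proof -
    have "finite (vertices P)" "card (vertices P) \<le> card {..<n}"
      using S[OF that] finite_vertices by auto
    then show ?thesis using card_le_inj[of "vertices P" "{..<n}"] by auto
  qed
  then obtain g where g: "\<And>P. P \<in> S \<Longrightarrow> inj_on (g P) (vertices P)"
      "\<And>P. P \<in> S \<Longrightarrow> g P ` vertices P \<subseteq> {..<n}"
    by metis
  let ?code = "\<lambda>P. face_code (g P) P" and ?cls = "\<lambda>P. comb_equiv_rel `` {P}"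
  have "?code ` S \<subseteq> Pow (Pow {..<n})"
    using g(2) by (fastforce simp: face_code_def vertices_face)
  then have fin: "finite (?code ` S)" by (rule finite_subset) simp
  have cls: "?cls P = ?cls Q" if "P \<in> S" "Q \<in> S" "?code P = ?code Q" for P Q
  proof -
    have "(P, Q) \<in> comb_equiv_rel"
      using combinatorially_equivalent_if_face_code_eq[OF _ g(1)[OF that(1)] _ g(1)[OF that(2)] that(3)]
        S that by (simp add: comb_equiv_rel_def)
    then show ?thesis using equiv_class_eq[OF equiv_comb_equiv_rel] by blast
  qed
  \<comment> \<open>Choosing any member of \<open>S\<close> with a given code turns the classes into
    an image of the finite set of codes.\<close>
  have "S // comb_equiv_rel \<subseteq> (\<lambda>C. ?cls (SOME P. P \<in> S \<and> ?code P = C)) ` ?code ` S"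
  proof
    fix X assume "X \<in> S // comb_equiv_rel"
    then obtain P where P: "P \<in> S" "X = ?cls P" by (auto simp: quotient_def)
    let ?Q = "SOME Q. Q \<in> S \<and> ?code Q = ?code P"
    have "?Q \<in> S \<and> ?code ?Q = ?code P" by (rule someI[of _ P]) (use P in simp)
    then have "X = ?cls ?Q" using cls[of P ?Q] P by simp
    then show "X \<in> (\<lambda>C. ?cls (SOME P. P \<in> S \<and> ?code P = C)) ` ?code ` S"
      using P by blast
  qed
  then show ?thesis using fin finite_subset by blast
qed

theorem theorem1p9:
  "finite ((forman_ricci_positive_3polytopes :: 'a::euclidean_space set set) // comb_equiv_rel) \<and>
   (\<forall>P \<in> (forman_ricci_positive_3polytopes :: 'a set set). card (vertices P) \<le> 15)"
proof (intro conjI ballI)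
  have le: "polytope P \<and> card (vertices P) \<le> 14"
    if "P \<in> (forman_ricci_positive_3polytopes :: 'a set set)" for P
    using that card_vertices_le_14 by (auto simp: forman_ricci_positive_3polytopes_def)
  then show "finite ((forman_ricci_positive_3polytopes :: 'a set set) // comb_equiv_rel)"
    by (rule finite_combinatorial_types)
  show "card (vertices P) \<le> 15" if "P \<in> (forman_ricci_positive_3polytopes :: 'a set set)" for P
    using le[OF that] by simp
qed

end
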